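(* Let $n\ge 1$ be an integer and let $A,B\in M_n(\mathbb{R})$. For $k\ge 1$ put $C_k:=\sum_{i=0}^{k-1}A^iBA^{(k-1)-i}$. The dual matrix $\mathcal{M}=A+B\epsilon\in M_n(\mathbb{D})$ is $\pi$-regular in $M_n(\mathbb{D})$ if and only if there exists an integer $k\ge 1$ such that $A^k$ is regular in $M_n(\mathbb{R})$ and $(I-A^k(A^k)^{-})\,C_k\,(I-(A^k)^{-}A^k)=0$ for some inner inverse $(A^k)^{-}\in M_n(\mathbb{R})$ of $A^k$.
   Context: $\mathbb{D}=\{a+b\epsilon \mid a,b\in\mathbb{R},\ \epsilon^2=0\}$ is the ring of dual numbers. $M_n(\mathbb{D})$ is the ring of $n\times n$ matrices over $\mathbb{D}$; each element is uniquely of the form $A+B\epsilon$ with $A,B\in M_n(\mathbb{R})$. An element $a$ of a ring $R$ (associative with identity) is (von Neumann) regular if there is $x\in R$ with $a=axa$; any such $x$ is called an inner inverse of $a$. An element $a\in R$ is $\pi$-regular if $a^m$ is regular for some integer $m\ge 1$, i.e. $a^m=a^mxa^m$ for some $x\in R$. $I$ is the $n\times n$ identity matrix. *)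

theory Defs
  imports
    Complex_Main
    "HOL-Algebra.Ring"
    "Jordan_Normal_Form.Matrix"
begin

section \<open>Dual numbers\<close>

datatype dual_number = Dual (std_part: real) (inf_part: real)

instantiation dual_number :: comm_ring_1
begin

definition "0 = Dual 0 0"
definition "1 = Dual 1 0"
definition "x + y = Dual (std_part x + std_part y) (inf_part x + inf_part y)"
definition "- x = Dual (- std_part x) (- inf_part x)"
definition "x - y = Dual (std_part x - std_part y) (inf_part x - inf_part y)"
definition "x * y =
  Dual (std_part x * std_part y) (std_part x * inf_part y + inf_part x * std_part y)"

instance
  by standard
    (auto simp: zero_dual_number_def one_dual_number_def plus_dual_number_def
      uminus_dual_number_def minus_dual_number_def times_dual_number_def algebra_simps)

end

instantiation dual_number :: real_algebra_1
begin

definition "scaleR r x = Dual (r * std_part x) (r * inf_part x)"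

instance
  by standard
    (auto simp: scaleR_dual_number_def plus_dual_number_def times_dual_number_def
      algebra_simps)

end

definition dual_eps :: dual_number where
  "dual_eps = Dual 0 1"

lemma dual_eps_square: "dual_eps * dual_eps = 0"
  by (simp add: dual_eps_def times_dual_number_def zero_dual_number_def)

lemma of_real_dual_number: "of_real a = Dual a 0"
  by (simp add: of_real_def scaleR_dual_number_def one_dual_number_def)

lemma Dual_conv_eps: "Dual a b = of_real a + of_real b * dual_eps"
  by (simp add: of_real_dual_number dual_eps_def times_dual_number_def plus_dual_number_def)


section \<open>Von Neumann regularity in a ring\<close>

definition inner_inverse :: "('a, 'b) ring_scheme \<Rightarrow> 'a \<Rightarrow> 'a \<Rightarrow> bool" where
  "inner_inverse R a x \<longleftrightarrow> x \<in> carrier R \<and> a = a \<otimes>\<^bsub>R\<^esub> x \<otimes>\<^bsub>R\<^esub> a"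

definition vn_regular :: "('a, 'b) ring_scheme \<Rightarrow> 'a \<Rightarrow> bool" where
  "vn_regular R a \<longleftrightarrow> a \<in> carrier R \<and> (\<exists>x. inner_inverse R a x)"

definition pi_regular :: "('a, 'b) ring_scheme \<Rightarrow> 'a \<Rightarrow> bool" where
  "pi_regular R a \<longleftrightarrow> a \<in> carrier R \<and> (\<exists>m::nat. m \<ge> 1 \<and> vn_regular R (a [^]\<^bsub>R\<^esub> m))"


section \<open>Matrices over the real and the dual numbers\<close>

abbreviation real_mat_ring :: "nat \<Rightarrow> real mat ring" where
  "real_mat_ring n \<equiv> ring_mat TYPE(real) n ()"

abbreviation dual_mat_ring :: "nat \<Rightarrow> dual_number mat ring" where
  "dual_mat_ring n \<equiv> ring_mat TYPE(dual_number) n ()"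

definition dual_mat :: "real mat \<Rightarrow> real mat \<Rightarrow> dual_number mat" where
  "dual_mat A B = map_mat of_real A + dual_eps \<cdot>\<^sub>m map_mat of_real B"

lemma dual_mat_unique_decomposition:
  assumes "M \<in> carrier (dual_mat_ring n)"
  shows "\<exists>!(A, B). A \<in> carrier (real_mat_ring n) \<and> B \<in> carrier (real_mat_ring n) \<and>
    M = dual_mat A B"
proof (rule ex1I[of _ "(map_mat std_part M, map_mat inf_part M)"], goal_cases)
  case 1
  show ?case using assms
    by (auto simp: ring_mat_simps dual_mat_def of_real_dual_number dual_eps_def
        times_dual_number_def plus_dual_number_def intro!: eq_matI)
next
  case (2 p)
  then show ?case
    by (cases p)
      (auto simp: ring_mat_simps dual_mat_def of_real_dual_number dual_eps_def
        times_dual_number_def plus_dual_number_def intro!: eq_matI)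
qed

text \<open>The sum is a \<open>finsum\<close> because matrices of unspecified dimension have no common zero;
  for \<open>k = 0\<close> it is the empty sum.\<close>

definition C_mat :: "nat \<Rightarrow> real mat \<Rightarrow> real mat \<Rightarrow> nat \<Rightarrow> real mat" where
  "C_mat n A B k =
    (\<Oplus>\<^bsub>real_mat_ring n\<^esub> i \<in> {0..<k}. A ^\<^sub>m i * B * A ^\<^sub>m (k - 1 - i))"

end

theory Submission
  imports Defs
begin

text \<open>The \<open>k\<close>-th power of \<open>A + B\<epsilon>\<close> is \<open>A\<^sup>k + C\<^sub>k\<epsilon>\<close>, so it suffices to decide regularity of
  \<open>P + Q\<epsilon>\<close>. An inner inverse \<open>X + Y\<epsilon>\<close> amounts to \<open>P = PXP\<close> and \<open>Q = PXQ + PYP + QXP\<close>. The second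
  equation is annihilated by sandwiching it between \<open>I - PX\<close> and \<open>I - XP\<close>; conversely, if the
  sandwiched \<open>Q\<close> vanishes, then \<open>Y = - XQX\<close> is a solution.\<close>

context ring
begin

text \<open>With \<open>e = \<one> \<ominus> p \<otimes> x\<close> and
  \<open>f = \<one> \<ominus> x \<otimes> p\<close>, the equation for \<open>p\<close> gives
  \<open>e \<otimes> p = \<zero>\<close> and \<open>p \<otimes> f = \<zero>\<close>. Two summands of
  \<open>q\<close> start with \<open>p\<close> and the third ends with \<open>p\<close>, so each
  dies.\<close>

lemma inner_inverse_sandwich_eq_zero:
  assumes [simp]: "p \<in> carrier R" "q \<in> carrier R" "x \<in> carrier R" "y \<in> carrier R"
    and p: "p \<otimes> x \<otimes> p = p"
    and q: "q = p \<otimes> x \<otimes> q \<oplus> p \<otimes> y \<otimes> p \<oplus> q \<otimes> x \<otimes> p"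
  shows "(\<one> \<ominus> p \<otimes> x) \<otimes> q \<otimes> (\<one> \<ominus> x \<otimes> p) = \<zero>"
proof -
  define e f where "e = \<one> \<ominus> p \<otimes> x" and "f = \<one> \<ominus> x \<otimes> p"
  have [simp]: "e \<in> carrier R" "f \<in> carrier R"
    by (auto simp: e_def f_def)
  have ep: "e \<otimes> p = \<zero>"
    using p by (simp add: e_def minus_eq l_distr l_minus r_neg)
  have pf: "p \<otimes> f = \<zero>"
    using p by (simp add: f_def minus_eq r_distr r_minus r_neg m_assoc)
  have "e \<otimes> q \<otimes> f = (e \<otimes> p) \<otimes> (x \<otimes> q \<otimes> f) \<oplus> (e \<otimes> p) \<otimes> (y \<otimes> p \<otimes> f) \<oplus> e \<otimes> q \<otimes> x \<otimes> (p \<otimes> f)"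
    by (subst q) (simp add: l_distr r_distr m_assoc)
  then show ?thesis
    by (simp add: ep pf flip: e_def f_def)
qed

text \<open>Expanding the sandwich gives \<open>q\<close> minus
  \<open>p \<otimes> x \<otimes> q\<close> minus \<open>q \<otimes> x \<otimes> p\<close> plus
  \<open>p \<otimes> x \<otimes> q \<otimes> x \<otimes> p\<close>. The last term dictates the
  choice of the middle factor.\<close>

lemma sandwich_eq_zero_decomposition:
  assumes [simp]: "p \<in> carrier R" "q \<in> carrier R" "x \<in> carrier R"
    and z: "(\<one> \<ominus> p \<otimes> x) \<otimes> q \<otimes> (\<one> \<ominus> x \<otimes> p) = \<zero>"
  shows "q = p \<otimes> x \<otimes> q \<oplus> p \<otimes> (\<ominus> (x \<otimes> q \<otimes> x)) \<otimes> p \<oplus> q \<otimes> x \<otimes> p"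
proof -
  have "q = (\<one> \<ominus> p \<otimes> x) \<otimes> q \<otimes> (\<one> \<ominus> x \<otimes> p)
    \<oplus> (p \<otimes> x \<otimes> q \<oplus> p \<otimes> (\<ominus> (x \<otimes> q \<otimes> x)) \<otimes> p \<oplus> q \<otimes> x \<otimes> p)"
    by (simp add: minus_eq l_distr r_distr l_minus r_minus m_assoc minus_add a_ac r_neg1 r_neg2
        r_neg l_neg)
  then show ?thesis
    by (simp add: z)
qed

end

text \<open>Subtraction in the ring structure goes through its abstract additive inverse, which
  uniqueness of inverses identifies with \<open>- B\<close>.\<close>

lemma a_minus_ring_mat:
  assumes "A \<in> carrier_mat n n" "B \<in> carrier_mat n n"
  shows "A \<ominus>\<^bsub>ring_mat TYPE('a :: comm_ring_1) n b\<^esub> B = A - B"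
proof -
  interpret ring "ring_mat TYPE('a) n b"
    by (rule ring_mat)
  have B: "- B \<in> carrier_mat n n" "B + - B = 0\<^sub>m n n" "- B + B = 0\<^sub>m n n"
    using assms by auto
  then have "\<ominus>\<^bsub>ring_mat TYPE('a) n b\<^esub> B = - B"
    using assms by (intro minus_equality) (auto simp: ring_mat_simps)
  then show ?thesis
    using assms by (simp add: minus_eq ring_mat_simps minus_add_uminus_mat)
qed

lemma pow_ring_mat: "A [^]\<^bsub>ring_mat TYPE('a :: semiring_1) n b\<^esub> (k :: nat) = A ^\<^sub>m k"
  if "A \<in> carrier_mat n n"
  using that by (induction k) (auto simp: ring_mat_simps nat_pow_def)

lemma dual_mat_carrier [simp]:
  "A \<in> carrier_mat n m \<Longrightarrow> B \<in> carrier_mat n m \<Longrightarrow> dual_mat A B \<in> carrier_mat n m"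
  by (auto simp: dual_mat_def)

lemma index_dual_mat:
  assumes "A \<in> carrier_mat n m" "B \<in> carrier_mat n m" "i < n" "j < m"
  shows "dual_mat A B $$ (i, j) = Dual (A $$ (i, j)) (B $$ (i, j))"
  using assms by (auto simp: dual_mat_def of_real_dual_number dual_eps_def
        times_dual_number_def plus_dual_number_def)

lemma dual_mat_eq_iff:
  assumes "A \<in> carrier_mat n m" "B \<in> carrier_mat n m" "C \<in> carrier_mat n m" "D \<in> carrier_mat n m"
  shows "dual_mat A B = dual_mat C D \<longleftrightarrow> A = C \<and> B = D"
proof
  assume eq: "dual_mat A B = dual_mat C D"
  have "A $$ (i, j) = C $$ (i, j) \<and> B $$ (i, j) = D $$ (i, j)" if "i < n" "j < m" for i j
    using index_dual_mat[OF assms(1,2) that] index_dual_mat[OF assms(3,4) that] eq by simp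
  then show "A = C \<and> B = D"
    using assms by (auto intro!: eq_matI)
qed auto

lemma sum_Dual: "(\<Sum>i\<in>I. Dual (f i) (g i)) = Dual (\<Sum>i\<in>I. f i) (\<Sum>i\<in>I. g i)"
  by (induction I rule: infinite_finite_induct)
    (auto simp: zero_dual_number_def plus_dual_number_def)

text \<open>The product \<open>B * D\<close> would carry the square of \<open>dual_eps\<close> and
  so vanishes. Entrywise this is the multiplication rule of \<open>dual_number\<close>, summed over
  the inner index.\<close>

lemma mult_dual_mat:
  assumes "A \<in> carrier_mat n m" "B \<in> carrier_mat n m" "C \<in> carrier_mat m l" "D \<in> carrier_mat m l"
  shows "dual_mat A B * dual_mat C D = dual_mat (A * C) (A * D + B * C)"
proof (rule eq_matI)
  have car: "A * C \<in> carrier_mat n l" "A * D + B * C \<in> carrier_mat n l"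
    "dual_mat A B \<in> carrier_mat n m" "dual_mat C D \<in> carrier_mat m l"
    using assms by auto
  show "dim_row (dual_mat A B * dual_mat C D) = dim_row (dual_mat (A * C) (A * D + B * C))"
    "dim_col (dual_mat A B * dual_mat C D) = dim_col (dual_mat (A * C) (A * D + B * C))"
    using car carrier_matD[OF dual_mat_carrier[OF car(1,2)]] by auto
  fix i j
  assume "i < dim_row (dual_mat (A * C) (A * D + B * C))"
    "j < dim_col (dual_mat (A * C) (A * D + B * C))"
  then have ij: "i < n" "j < l"
    using dual_mat_carrier[OF car(1,2)] by auto
  have "(dual_mat A B * dual_mat C D) $$ (i, j)
      = (\<Sum>k<m. dual_mat A B $$ (i, k) * dual_mat C D $$ (k, j))"
    using car(3,4) ij by (auto simp: scalar_prod_def atLeast0LessThan)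
  also have "\<dots> = (\<Sum>k<m. Dual (A $$ (i, k) * C $$ (k, j))
      (A $$ (i, k) * D $$ (k, j) + B $$ (i, k) * C $$ (k, j)))"
    by (intro sum.cong refl)
      (simp add: index_dual_mat[OF assms(1,2) ij(1)] index_dual_mat[OF assms(3,4) _ ij(2)]
        times_dual_number_def)
  also have "\<dots> = Dual ((A * C) $$ (i, j)) ((A * D + B * C) $$ (i, j))"
    using assms ij by (auto simp: sum_Dual scalar_prod_def atLeast0LessThan sum.distrib)
  finally show "(dual_mat A B * dual_mat C D) $$ (i, j) = dual_mat (A * C) (A * D + B * C) $$ (i, j)"
    by (simp add: index_dual_mat[OF car(1,2) ij])
qed

text \<open>A Leibniz rule for three factors: each summand of the infinitesimal part takes that part
  from exactly one factor.\<close>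

lemma dual_mat_sandwich:
  assumes "P \<in> carrier_mat n n" "Q \<in> carrier_mat n n" "X \<in> carrier_mat n n" "Y \<in> carrier_mat n n"
  shows "dual_mat P Q * dual_mat X Y * dual_mat P Q
    = dual_mat (P * X * P) (P * X * Q + P * Y * P + Q * X * P)"
proof -
  have "dual_mat P Q * dual_mat X Y * dual_mat P Q
      = dual_mat (P * X * P) (P * X * Q + (P * Y + Q * X) * P)"
    using assms by (simp add: mult_dual_mat[of _ n n])
  also have "P * X * Q + (P * Y + Q * X) * P = P * X * Q + P * Y * P + Q * X * P"
    using assms by (simp add: add_mult_distrib_mat[of _ n n] assoc_add_mat[of _ n n])
  finally show ?thesis .
qed

text \<open>In both directions \<open>X\<close> is the standard part of a dual inner inverse; only
  the infinitesimal part \<open>Y\<close> has to be eliminated or constructed.\<close>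

lemma vn_regular_dual_mat_iff:
  assumes P: "P \<in> carrier_mat n n" and Q: "Q \<in> carrier_mat n n"
  shows "vn_regular (dual_mat_ring n) (dual_mat P Q) \<longleftrightarrow>
    (\<exists>X. inner_inverse (real_mat_ring n) P X \<and>
      (1\<^sub>m n - P * X) * Q * (1\<^sub>m n - X * P) = 0\<^sub>m n n)"
    (is "_ \<longleftrightarrow> ?rhs")
proof -
  interpret R: ring "real_mat_ring n"
    by (rule ring_mat)
  \<comment> \<open>Translates the conclusion of the abstract ring lemmas into matrix operations;
    both directions use it.\<close>
  have sandwich: "(\<one>\<^bsub>real_mat_ring n\<^esub> \<ominus>\<^bsub>real_mat_ring n\<^esub> P \<otimes>\<^bsub>real_mat_ring n\<^esub> X)
      \<otimes>\<^bsub>real_mat_ring n\<^esub> Q \<otimes>\<^bsub>real_mat_ring n\<^esub>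
      (\<one>\<^bsub>real_mat_ring n\<^esub> \<ominus>\<^bsub>real_mat_ring n\<^esub> X \<otimes>\<^bsub>real_mat_ring n\<^esub> P)
      = (1\<^sub>m n - P * X) * Q * (1\<^sub>m n - X * P)" if "X \<in> carrier_mat n n" for X
  proof -
    have "P * X \<in> carrier_mat n n" "X * P \<in> carrier_mat n n"
      using that P by auto
    then show ?thesis
      by (simp add: ring_mat_simps a_minus_ring_mat)
  qed
  show ?thesis
  proof
    assume "vn_regular (dual_mat_ring n) (dual_mat P Q)"
    then obtain Z where Z: "Z \<in> carrier (dual_mat_ring n)"
      and eq: "dual_mat P Q = dual_mat P Q * Z * dual_mat P Q"
      by (auto simp: vn_regular_def inner_inverse_def ring_mat_simps)
    from dual_mat_unique_decomposition[OF Z] obtain X Y where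
      XY: "X \<in> carrier_mat n n" "Y \<in> carrier_mat n n" and "Z = dual_mat X Y"
      by (auto simp: ring_mat_simps)
    with eq have "dual_mat P Q = dual_mat (P * X * P) (P * X * Q + P * Y * P + Q * X * P)"
      using dual_mat_sandwich[OF P Q] by simp
    then have pq: "P = P * X * P" "Q = P * X * Q + P * Y * P + Q * X * P"
      using P Q XY by (auto simp: dual_mat_eq_iff[of _ n n])
    have "(1\<^sub>m n - P * X) * Q * (1\<^sub>m n - X * P) = 0\<^sub>m n n"
      using R.inner_inverse_sandwich_eq_zero[of P Q X Y] P Q XY pq
      unfolding sandwich[OF XY(1)] by (simp add: ring_mat_simps)
    with pq(1) XY(1) show ?rhs
      by (auto simp: inner_inverse_def ring_mat_simps)
  next
    assume ?rhs
    then obtain X where X: "X \<in> carrier_mat n n" and p: "P = P * X * P"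
      and z: "(1\<^sub>m n - P * X) * Q * (1\<^sub>m n - X * P) = 0\<^sub>m n n"
      by (auto simp: inner_inverse_def ring_mat_simps)
    \<comment> \<open>The inverse is taken in the ring so that \<open>Y\<close> has literally the
      form in \<open>sandwich_eq_zero_decomposition\<close>.\<close>
    define Y where "Y = \<ominus>\<^bsub>real_mat_ring n\<^esub> (X * Q * X)"
    have Y: "Y \<in> carrier_mat n n"
      using R.a_inv_closed[of "X * Q * X"] X Q unfolding Y_def by (simp add: ring_mat_simps)
    have q: "Q = P * X * Q + P * Y * P + Q * X * P"
      using R.sandwich_eq_zero_decomposition[of P Q X] P Q X z
      unfolding sandwich[OF X] Y_def by (simp add: ring_mat_simps)
    have "dual_mat P Q = dual_mat P Q * dual_mat X Y * dual_mat P Q"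
      using dual_mat_sandwich[OF P Q X Y] p q by simp
    with X Y P Q show "vn_regular (dual_mat_ring n) (dual_mat P Q)"
      by (auto simp: vn_regular_def inner_inverse_def ring_mat_simps intro!: exI[of _ "dual_mat X Y"])
  qed
qed

lemma C_mat_carrier:
  assumes "A \<in> carrier_mat n n" "B \<in> carrier_mat n n"
  shows "C_mat n A B k \<in> carrier_mat n n"
proof -
  interpret ring "real_mat_ring n"
    by (rule ring_mat)
  have "C_mat n A B k \<in> carrier (real_mat_ring n)"
    unfolding C_mat_def using assms by (intro finsum_closed) (auto simp: ring_mat_simps)
  then show ?thesis
    by (simp add: ring_mat_simps)
qed

lemma C_mat_0: "C_mat n A B 0 = 0\<^sub>m n n"
proof -
  interpret ring "real_mat_ring n"
    by (rule ring_mat)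
  show ?thesis
    by (simp add: C_mat_def) (simp add: ring_mat_simps)
qed

text \<open>The top summand \<open>i = k\<close> ends in the zeroth power of \<open>A\<close>, and
  every other summand gains one factor \<open>A\<close> on the right. The result is the
  infinitesimal part of the \<open>k\<close>-th power of \<open>dual_mat A B\<close> times
  \<open>dual_mat A B\<close>.\<close>

lemma C_mat_Suc:
  assumes A: "A \<in> carrier_mat n n" and B: "B \<in> carrier_mat n n"
  shows "C_mat n A B (Suc k) = A ^\<^sub>m k * B + C_mat n A B k * A"
proof -
  interpret R: ring "real_mat_ring n"
    by (rule ring_mat)
  let ?f = "\<lambda>i. A ^\<^sub>m i * B * A ^\<^sub>m (k - 1 - i)"
  let ?g = "\<lambda>i. A ^\<^sub>m i * B * A ^\<^sub>m (k - i)"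
  have car: "?f i \<in> carrier_mat n n" "?g i \<in> carrier_mat n n" for i
    using A B by auto
  \<comment> \<open>The bound \<open>i < k\<close> keeps the truncated subtraction
    \<open>k - 1 - i\<close> exact.\<close>
  have g: "?g i = ?f i * A" if "i < k" for i
  proof -
    have "k - i = Suc (k - 1 - i)"
      using that by simp
    then have "?g i = A ^\<^sub>m i * B * (A ^\<^sub>m (k - 1 - i) * A)"
      by simp
    also have "\<dots> = ?f i * A"
      using A B by (intro assoc_mult_mat[symmetric]) auto
    finally show ?thesis .
  qed
  have "C_mat n A B (Suc k) = ?g k \<oplus>\<^bsub>real_mat_ring n\<^esub> finsum (real_mat_ring n) ?g {0..<k}"
    unfolding C_mat_def atLeast0_lessThan_Suc diff_Suc_1
    using A B by (intro R.finsum_insert) (auto simp: ring_mat_simps)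
  also have "finsum (real_mat_ring n) ?g {0..<k}
      = finsum (real_mat_ring n) (\<lambda>i. ?f i \<otimes>\<^bsub>real_mat_ring n\<^esub> A) {0..<k}"
    using g car A by (intro R.finsum_cong') (auto simp: ring_mat_simps)
  also have "\<dots> = finsum (real_mat_ring n) ?f {0..<k} \<otimes>\<^bsub>real_mat_ring n\<^esub> A"
    using car A by (intro R.finsum_ldistr[symmetric]) (auto simp: ring_mat_simps)
  finally show ?thesis
    using A B by (simp add: ring_mat_simps C_mat_def)
qed

lemma one_dual_mat: "1\<^sub>m n = dual_mat (1\<^sub>m n) (0\<^sub>m n n)"
  by (rule eq_matI)
    (auto simp: dual_mat_def of_real_dual_number dual_eps_def times_dual_number_def
      plus_dual_number_def one_dual_number_def zero_dual_number_def)

lemma pow_dual_mat: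
  assumes A: "A \<in> carrier_mat n n" and B: "B \<in> carrier_mat n n"
  shows "dual_mat A B ^\<^sub>m k = dual_mat (A ^\<^sub>m k) (C_mat n A B k)"
proof (induction k)
  case 0
  \<comment> \<open>The zeroth matrix power is the identity of size \<open>dim_row\<close>, so this
    size must be known.\<close>
  have "dim_row (dual_mat A B) = n"
    using dual_mat_carrier[OF A B] by auto
  then show ?case
    using A by (simp add: C_mat_0 one_dual_mat)
next
  case (Suc k)
  then show ?case
    using A B C_mat_carrier[OF A B, of k]
    by (simp add: mult_dual_mat[of _ n n] C_mat_Suc)
qed

theorem proposition3p4:
  fixes n :: nat and A B :: "real mat"
  assumes "n \<ge> 1"
    and "A \<in> carrier_mat n n"
    and "B \<in> carrier_mat n n"
  shows "pi_regular (dual_mat_ring n) (dual_mat A B) \<longleftrightarrow>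
    (\<exists>k::nat. k \<ge> 1 \<and> vn_regular (real_mat_ring n) (A ^\<^sub>m k) \<and>
      (\<exists>X. inner_inverse (real_mat_ring n) (A ^\<^sub>m k) X \<and>
        (1\<^sub>m n - A ^\<^sub>m k * X) * C_mat n A B k * (1\<^sub>m n - X * A ^\<^sub>m k) = 0\<^sub>m n n))"
proof -
  \<comment> \<open>The equivalence holds for each exponent separately, so the same number serves as
    \<open>m\<close> and as \<open>k\<close>.\<close>
  have "vn_regular (dual_mat_ring n) (dual_mat A B [^]\<^bsub>dual_mat_ring n\<^esub> k) \<longleftrightarrow>
      (\<exists>X. inner_inverse (real_mat_ring n) (A ^\<^sub>m k) X \<and>
        (1\<^sub>m n - A ^\<^sub>m k * X) * C_mat n A B k * (1\<^sub>m n - X * A ^\<^sub>m k) = 0\<^sub>m n n)" for k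
    using assms(2,3) C_mat_carrier[OF assms(2,3)]
    by (simp add: pow_ring_mat pow_dual_mat vn_regular_dual_mat_iff)
  moreover have "dual_mat A B \<in> carrier (dual_mat_ring n)"
    using assms(2,3) by (simp add: ring_mat_simps)
  moreover have "A ^\<^sub>m k \<in> carrier (real_mat_ring n)" for k
    using assms(2) by (simp add: ring_mat_simps)
  ultimately show ?thesis
    \<comment> \<open>From left to right, the witness \<open>X\<close> also certifies regularity of
      \<open>A ^\<^sub>m k\<close>.\<close>
    unfolding pi_regular_def vn_regular_def[of "real_mat_ring n"] by blast
qed

end
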